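(* Let $N\subseteq M$ be a connected unital inclusion of finite dimensional $C^*$-algebras, let $tr$ be its unique Markov trace on $M$, and let $\alpha_0$ be an automorphism of $M$ such that $\alpha_0(N)=N$. Then $\alpha_0$ is automatically trace preserving, that is, $tr\circ\alpha_0=tr$.
   Context: An automorphism means a $*$-automorphism. Connected means that the Bratteli diagram of the inclusion is connected. For an inclusion $N\subseteq M$ with faithful tracial state $tr$ on $M$, $M_1=\langle M,e_1\rangle$ is Jones' basic construction, generated on $L^2(M,tr)$ by $M$ and the orthogonal projection $e_1$ onto $L^2(N,tr)$. The faithful tracial state $tr$ on $M$ is a Markov trace of modulus $\tau$ if it extends to a positive trace $Tr$ on $M_1$ with $Tr(xe_1)=\tau\,tr(x)$ for $x\in M$. For a connected inclusion of finite dimensional $C^*$-algebras with inclusion matrix $G$ there is a unique (normalized) Markov trace, with modulus $\tau=\|G\|^{-2}$. *)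

theory Defs
  imports "HOL-Analysis.Analysis" "Graph_Theory.Digraph_Component"
begin

section \<open>Unital C*-algebras\<close>

text \<open>The sort \<open>real_normed_algebra_1\<close> requires \<open>norm 1 = 1\<close>, which holds in every nonzero
  unital C*-algebra.\<close>

class unital_cstar_algebra = real_normed_algebra_1 + banach +
  fixes scaleC :: "complex \<Rightarrow> 'a \<Rightarrow> 'a" (infixr \<open>*\<^sub>C\<close> 75)
    and star :: "'a \<Rightarrow> 'a"
  assumes scaleC_add_right: "c *\<^sub>C (x + y) = c *\<^sub>C x + c *\<^sub>C y"
    and scaleC_add_left: "(c + d) *\<^sub>C x = c *\<^sub>C x + d *\<^sub>C x"
    and scaleC_scaleC: "c *\<^sub>C (d *\<^sub>C x) = (c * d) *\<^sub>C x"
    and scaleC_complex_of_real: "complex_of_real r *\<^sub>C x = r *\<^sub>R x"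
    and mult_scaleC_left: "(c *\<^sub>C x) * y = c *\<^sub>C (x * y)"
    and mult_scaleC_right: "x * (c *\<^sub>C y) = c *\<^sub>C (x * y)"
    and norm_scaleC: "norm (c *\<^sub>C x) = cmod c * norm x"
    and star_add: "star (x + y) = star x + star y"
    and star_scaleC: "star (c *\<^sub>C x) = cnj c *\<^sub>C star x"
    and star_mult: "star (x * y) = star y * star x"
    and star_star: "star (star x) = x"
    and cstar_identity: "norm (star x * x) = (norm x)\<^sup>2"

interpretation complex_space:
  vector_space "scaleC :: complex \<Rightarrow> 'a \<Rightarrow> 'a::unital_cstar_algebra"
proof
  show "1 *\<^sub>C x = x" for x :: 'a
    using scaleC_complex_of_real[of 1 x] by simp
qed (simp_all add: scaleC_add_right scaleC_add_left scaleC_scaleC)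

definition finite_dimensional_cstar :: "'a::unital_cstar_algebra itself \<Rightarrow> bool" where
  "finite_dimensional_cstar _ \<longleftrightarrow>
     (\<exists>B :: 'a set. finite B \<and> complex_space.span B = UNIV)"

definition unital_cstar_subalgebra :: "'a::unital_cstar_algebra set \<Rightarrow> bool" where
  "unital_cstar_subalgebra N \<longleftrightarrow>
     complex_space.subspace N \<and> closed N \<and> 1 \<in> N \<and>
     (\<forall>x\<in>N. \<forall>y\<in>N. x * y \<in> N) \<and> (\<forall>x\<in>N. star x \<in> N)"

definition star_automorphism :: "('a::unital_cstar_algebra \<Rightarrow> 'a) \<Rightarrow> bool" where
  "star_automorphism \<alpha> \<longleftrightarrow>
     Vector_Spaces.linear scaleC scaleC \<alpha> \<and> bij \<alpha> \<and>
     (\<forall>x y. \<alpha> (x * y) = \<alpha> x * \<alpha> y) \<and> (\<forall>x. \<alpha> (star x) = star (\<alpha> x))"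

section \<open>Bratteli diagrams\<close>

definition projection :: "'a::unital_cstar_algebra \<Rightarrow> bool" where
  "projection p \<longleftrightarrow> p * p = p \<and> star p = p"

definition minimal_projections :: "'a::unital_cstar_algebra set \<Rightarrow> 'a set" where
  "minimal_projections A =
     {p \<in> A. projection p \<and> p \<noteq> 0 \<and>
        (\<forall>q\<in>A. projection q \<and> q * p = q \<longrightarrow> q = 0 \<or> q = p)}"

definition center :: "'a::unital_cstar_algebra set \<Rightarrow> 'a set" where
  "center A = {z \<in> A. \<forall>x\<in>A. z * x = x * z}"

text \<open>The minimal projections of the center are the units of the simple summands, so they index
  these summands.\<close>

abbreviation minimal_central_projections :: "'a::unital_cstar_algebra set \<Rightarrow> 'a set" where
  "minimal_central_projections A \<equiv> minimal_projections (center A)"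

text \<open>The entry of the inclusion matrix of \<open>N \<subseteq> M\<close> (with \<open>M\<close> the whole type) at the simple summands
  \<open>Np\<close> and \<open>Mq\<close>: for any minimal projection \<open>f\<close> of \<open>Np\<close>, the projection \<open>fq\<close> is the sum of that many
  mutually orthogonal minimal projections of \<open>M\<close>. In finite dimension the number exists and depends
  on \<open>p\<close> and \<open>q\<close> only.\<close>

definition inclusion_matrix :: "'a::unital_cstar_algebra set \<Rightarrow> 'a \<Rightarrow> 'a \<Rightarrow> nat" where
  "inclusion_matrix N p q =
     (THE n. \<exists>f \<in> minimal_projections N. f * p = f \<and>
        (\<exists>F. finite F \<and> card F = n \<and> F \<subseteq> minimal_projections UNIV \<and>
             (\<forall>g\<in>F. \<forall>h\<in>F. g \<noteq> h \<longrightarrow> g * h = 0) \<and> f * q = \<Sum>F))"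

text \<open>A bipartite multigraph, with \<open>inclusion_matrix N p q\<close> edges between \<open>p\<close> and \<open>q\<close>. The
  orientation of the arcs from \<open>N\<close> to \<open>M\<close> is irrelevant, as \<^const>\<open>Digraph_Component.connected\<close>
  symmetrizes the graph.\<close>

definition bratteli_diagram ::
  "'a::unital_cstar_algebra set \<Rightarrow> ('a + 'a, 'a \<times> 'a \<times> nat) pre_digraph" where
  "bratteli_diagram N =
     \<lparr> verts = Inl ` minimal_central_projections N \<union> Inr ` minimal_central_projections UNIV,
       arcs = {(p, q, k). p \<in> minimal_central_projections N \<and>
                          q \<in> minimal_central_projections UNIV \<and> k < inclusion_matrix N p q},
       tail = (\<lambda>(p, q, k). Inl p),
       head = (\<lambda>(p, q, k). Inr q) \<rparr>"

definition connected_inclusion :: "'a::unital_cstar_algebra set \<Rightarrow> bool" where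
  "connected_inclusion N \<longleftrightarrow> Digraph_Component.connected (bratteli_diagram N)"

section \<open>The basic construction and Markov traces\<close>

definition faithful_tracial_state :: "('a::unital_cstar_algebra \<Rightarrow> complex) \<Rightarrow> bool" where
  "faithful_tracial_state tr \<longleftrightarrow>
     Vector_Spaces.linear scaleC (*) tr \<and> tr 1 = 1 \<and>
     (\<forall>x. tr (star x * x) \<in> \<real>\<^sub>\<ge>\<^sub>0) \<and> (\<forall>x. tr (star x * x) = 0 \<longrightarrow> x = 0) \<and>
     (\<forall>x y. tr (x * y) = tr (y * x))"

text \<open>For \<open>M\<close> finite dimensional and \<open>tr\<close> faithful, the space \<open>L\<^sup>2(M,tr)\<close> is \<open>M\<close> itself with the
  following inner product, and \<open>L\<^sup>2(N,tr)\<close> is its subspace \<open>N\<close>. Operators on \<open>L\<^sup>2(M,tr)\<close> are therefore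
  functions from \<open>M\<close> to \<open>M\<close>, and \<open>x \<in> M\<close> acts as \<open>(*) x\<close>.\<close>

definition l2_inner :: "('a::unital_cstar_algebra \<Rightarrow> complex) \<Rightarrow> 'a \<Rightarrow> 'a \<Rightarrow> complex" where
  "l2_inner tr x y = tr (star y * x)"

definition l2_adjoint ::
  "('a::unital_cstar_algebra \<Rightarrow> complex) \<Rightarrow> ('a \<Rightarrow> 'a) \<Rightarrow> ('a \<Rightarrow> 'a) \<Rightarrow> bool" where
  "l2_adjoint tr T S \<longleftrightarrow> (\<forall>x y. l2_inner tr (T x) y = l2_inner tr x (S y))"

definition jones_projection ::
  "'a::unital_cstar_algebra set \<Rightarrow> ('a \<Rightarrow> complex) \<Rightarrow> 'a \<Rightarrow> 'a" where
  "jones_projection N tr x = (THE z. z \<in> N \<and> (\<forall>y\<in>N. l2_inner tr (x - z) y = 0))"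

text \<open>The *-algebra generated by \<open>M\<close> and \<open>e\<^sub>1\<close>; in finite dimension no closure is needed.\<close>

inductive_set basic_construction ::
  "'a::unital_cstar_algebra set \<Rightarrow> ('a \<Rightarrow> complex) \<Rightarrow> ('a \<Rightarrow> 'a) set"
  for N :: "'a set" and tr :: "'a \<Rightarrow> complex" where
  left_mult: "(*) x \<in> basic_construction N tr"
| jones_proj: "jones_projection N tr \<in> basic_construction N tr"
| add: "S \<in> basic_construction N tr \<Longrightarrow> T \<in> basic_construction N tr \<Longrightarrow>
    (\<lambda>x. S x + T x) \<in> basic_construction N tr"
| scale: "T \<in> basic_construction N tr \<Longrightarrow> (\<lambda>x. c *\<^sub>C T x) \<in> basic_construction N tr"
| comp: "S \<in> basic_construction N tr \<Longrightarrow> T \<in> basic_construction N tr \<Longrightarrow>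
    S \<circ> T \<in> basic_construction N tr"
| adjoint: "T \<in> basic_construction N tr \<Longrightarrow> l2_adjoint tr T S \<Longrightarrow>
    S \<in> basic_construction N tr"

definition positive_trace_on_basic_construction ::
  "'a::unital_cstar_algebra set \<Rightarrow> ('a \<Rightarrow> complex) \<Rightarrow> (('a \<Rightarrow> 'a) \<Rightarrow> complex) \<Rightarrow> bool" where
  "positive_trace_on_basic_construction N tr Tr \<longleftrightarrow>
     (\<forall>S\<in>basic_construction N tr. \<forall>T\<in>basic_construction N tr.
        Tr (\<lambda>x. S x + T x) = Tr S + Tr T) \<and>
     (\<forall>T\<in>basic_construction N tr. \<forall>c. Tr (\<lambda>x. c *\<^sub>C T x) = c * Tr T) \<and>
     (\<forall>T\<in>basic_construction N tr. \<forall>S. l2_adjoint tr T S \<longrightarrow> Tr (S \<circ> T) \<in> \<real>\<^sub>\<ge>\<^sub>0) \<and>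
     (\<forall>S\<in>basic_construction N tr. \<forall>T\<in>basic_construction N tr. Tr (S \<circ> T) = Tr (T \<circ> S))"

definition markov_trace_of_modulus ::
  "'a::unital_cstar_algebra set \<Rightarrow> ('a \<Rightarrow> complex) \<Rightarrow> real \<Rightarrow> bool" where
  "markov_trace_of_modulus N tr \<tau> \<longleftrightarrow>
     faithful_tracial_state tr \<and>
     (\<exists>Tr. positive_trace_on_basic_construction N tr Tr \<and>
        (\<forall>x. Tr ((*) x) = tr x) \<and>
        (\<forall>x. Tr ((*) x \<circ> jones_projection N tr) = complex_of_real \<tau> * tr x))"

definition markov_trace ::
  "'a::unital_cstar_algebra set \<Rightarrow> ('a \<Rightarrow> complex) \<Rightarrow> bool" where
  "markov_trace N tr \<longleftrightarrow> (\<exists>\<tau>. markov_trace_of_modulus N tr \<tau>)"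

end

theory Submission
  imports Defs "HOL-Computational_Algebra.Fundamental_Theorem_Algebra"
begin

text \<open>The trace \<open>tr \<circ> \<alpha>\<^sub>0\<close> has a central density \<open>h\<close> with respect to \<open>tr\<close>. Let \<open>E\<close> be the
  \<open>tr\<close>-preserving conditional expectation onto \<open>N\<close>, let \<open>u\<close> and \<open>v\<close> run through orthonormal bases
  of \<open>L\<^sup>2(M,tr)\<close> and \<open>L\<^sup>2(N,tr)\<close>, and let \<open>w\<close> be the inverse of \<open>\<Sum> v v\<^sup>*\<close>, which is central in \<open>N\<close>. Then
  \<open>\<Sum> u w E(u\<^sup>* x) = x\<close>, so the Markov property says \<open>\<tau> \<Sum> u w u\<^sup>* = 1\<close>. Transporting this identity by
  the inverse of \<open>\<alpha>\<^sub>0\<close> gives the analogue for \<open>tr \<circ> \<alpha>\<^sub>0\<close>, which reads \<open>\<tau> \<Sum> u w E(h) u\<^sup>* = h\<close>. Instead of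
  the Perron--Frobenius theorem a Dirichlet form is used: the two identities yield
  \<open>tr (w (h - E h)\<^sup>2) = 0\<close>, hence \<open>h = E h\<close> lies in the centers of both \<open>N\<close> and \<open>M\<close>. As the
  Bratteli diagram is connected, the intersection of the centers contains no nontrivial projection,
  so \<open>h\<close> is a scalar, and \<open>tr h = 1\<close>.\<close>

section \<open>Star subalgebras, their centers and bases of subspaces\<close>

lemma star_one [simp]: "star (1::'a::unital_cstar_algebra) = 1"
  by (metis mult.right_neutral star_mult star_star)

lemma scaleC_zero_right [simp]: "c *\<^sub>C 0 = (0::'a::unital_cstar_algebra)"
  by (rule complex_space.scale_zero_right)

lemma star_zero [simp]: "star (0::'a::unital_cstar_algebra) = 0"
  by (metis add_cancel_right_right star_add)

lemma star_diff: "star (x - y) = star x - star (y::'a::unital_cstar_algebra)"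
  by (metis add_diff_cancel diff_add_cancel star_add)

lemma star_sum: "star (sum f I) = (\<Sum>i\<in>I. star (f i :: 'a::unital_cstar_algebra))"
  by (induction I rule: infinite_finite_induct) (auto simp: star_add)

definition star_subalgebra :: "'a::unital_cstar_algebra set \<Rightarrow> bool" where
  "star_subalgebra A \<longleftrightarrow>
     complex_space.subspace A \<and> 1 \<in> A \<and> (\<forall>x\<in>A. \<forall>y\<in>A. x * y \<in> A) \<and> (\<forall>x\<in>A. star x \<in> A)"

lemma star_subalgebra_UNIV: "star_subalgebra (UNIV :: 'a::unital_cstar_algebra set)"
  by (simp add: star_subalgebra_def complex_space.subspace_UNIV)

lemma unital_cstar_subalgebra_imp_star_subalgebra:
  "unital_cstar_subalgebra N \<Longrightarrow> star_subalgebra N"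
  by (simp add: star_subalgebra_def unital_cstar_subalgebra_def)

lemma star_subalgebra_Int:
  "star_subalgebra A \<Longrightarrow> star_subalgebra B \<Longrightarrow> star_subalgebra (A \<inter> B)"
  by (auto simp: star_subalgebra_def complex_space.subspace_inter)

lemma centerI: "z \<in> A \<Longrightarrow> (\<And>x. x \<in> A \<Longrightarrow> z * x = x * z) \<Longrightarrow> z \<in> center A"
  by (simp add: center_def)

lemma center_commute: "z \<in> center A \<Longrightarrow> x \<in> A \<Longrightarrow> z * x = x * z"
  by (simp add: center_def)

lemma center_in: "z \<in> center A \<Longrightarrow> z \<in> A"
  by (simp add: center_def)

lemma star_subalgebra_center:
  assumes A: "star_subalgebra A"
  shows "star_subalgebra (center A)"
  unfolding star_subalgebra_def complex_space.subspace_def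
proof (intro conjI ballI allI)
  have sub: "complex_space.subspace A" using A by (simp add: star_subalgebra_def)
  show "0 \<in> center A" using complex_space.subspace_0[OF sub] by (simp add: center_def)
  show "1 \<in> center A" using A by (simp add: center_def star_subalgebra_def)
  fix z assume z: "z \<in> center A"
  show "star z \<in> center A"
  proof (rule centerI)
    show "star z \<in> A" using A center_in[OF z] by (simp add: star_subalgebra_def)
    fix x assume "x \<in> A"
    then have "star x \<in> A" using A by (simp add: star_subalgebra_def)
    then have "star (z * star x) = star (star x * z)" using center_commute[OF z] by simp
    then show "star z * x = x * star z" by (simp add: star_mult star_star)
  qed
  show "c *\<^sub>C z \<in> center A" for c
    using complex_space.subspace_scale[OF sub center_in[OF z]] center_commute[OF z]
    by (intro centerI) (simp_all add: mult_scaleC_left mult_scaleC_right)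
  fix y assume y: "y \<in> center A"
  show "z + y \<in> center A"
    using complex_space.subspace_add[OF sub center_in[OF z] center_in[OF y]]
      center_commute[OF z] center_commute[OF y]
    by (intro centerI) (simp_all add: distrib_left distrib_right)
  show "z * y \<in> center A"
  proof (rule centerI)
    show "z * y \<in> A" using A center_in[OF z] center_in[OF y] by (simp add: star_subalgebra_def)
    fix x assume x: "x \<in> A"
    have "z * y * x = z * x * y" using center_commute[OF y x] by (simp add: mult.assoc)
    also have "\<dots> = x * (z * y)" using center_commute[OF z x] by (simp add: mult.assoc)
    finally show "z * y * x = x * (z * y)" .
  qed
qed

lemma finite_dimensional_basis:
  assumes "finite_dimensional_cstar TYPE('a::unital_cstar_algebra)"
    and "complex_space.subspace (V :: 'a set)"
  obtains B where "finite B" "B \<subseteq> V" "complex_space.span B = V"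
proof -
  obtain T :: "'a set" where T: "finite T" "complex_space.span T = UNIV"
    using assms(1) by (auto simp: finite_dimensional_cstar_def)
  obtain B where B: "B \<subseteq> V" "complex_space.independent B" "V \<subseteq> complex_space.span B"
    by (metis complex_space.maximal_independent_subset)
  have "finite B" using complex_space.independent_span_bound[OF T(1) B(2)] T(2) by auto
  moreover have "complex_space.span B = V"
    using B assms(2) by (metis complex_space.span_minimal subset_antisym)
  ultimately show ?thesis using that B by blast
qed

lemma subspace_mult_image:
  assumes "complex_space.subspace A"
  shows "complex_space.subspace ((*) c ` (A :: 'a::unital_cstar_algebra set))"
  unfolding complex_space.subspace_def
proof (intro conjI ballI allI)
  show "0 \<in> (*) c ` A"
    using complex_space.subspace_0[OF assms] by (intro image_eqI[of _ _ 0]) auto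
next
  fix x y assume "x \<in> (*) c ` A" "y \<in> (*) c ` A"
  then show "x + y \<in> (*) c ` A"
    using complex_space.subspace_add[OF assms] by (auto simp flip: distrib_left)
next
  fix a x assume "x \<in> (*) c ` A"
  then show "a *\<^sub>C x \<in> (*) c ` A"
    using complex_space.subspace_scale[OF assms] by (auto simp flip: mult_scaleC_right)
qed

section \<open>Projections and the Bratteli diagram\<close>

text \<open>Descent on the dimension of the right ideal generated by \<open>p\<close>: a projection
  \<open>q\<close> strictly below \<open>p\<close> generates a strictly smaller ideal, because
  \<open>p\<close> itself lies outside it.\<close>

lemma exists_minimal_projection:
  assumes fd: "finite_dimensional_cstar TYPE('a::unital_cstar_algebra)"
    and "(p :: 'a) \<in> A" "projection p" "p \<noteq> 0"
  shows "\<exists>q\<in>minimal_projections A. q * p = q"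
  using assms(2-4)
proof (induction "complex_space.dim (range ((*) p))" arbitrary: p rule: less_induct)
  case (less p)
  obtain T :: "'a set" where T: "finite T" "complex_space.span T = UNIV"
    using fd by (auto simp: finite_dimensional_cstar_def)
  obtain B :: "'a set" where B: "complex_space.independent B" "UNIV \<subseteq> complex_space.span B"
    by (metis complex_space.maximal_independent_subset)
  have "finite B" using complex_space.independent_span_bound[OF T(1) B(1)] T(2) by auto
  then interpret fd: finite_dimensional_vector_space "scaleC :: complex \<Rightarrow> 'a \<Rightarrow> 'a" B
    using B by unfold_locales auto
  have pp: "p * p = p" and sp: "star p = p" using less.prems by (auto simp: projection_def)
  show ?case
  proof (cases "p \<in> minimal_projections A")
    case True
    then show ?thesis using pp by blast
  next
    case False
    then obtain q where q: "q \<in> A" "projection q" "q * p = q" "q \<noteq> 0" "q \<noteq> p"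
      using less.prems by (auto simp: minimal_projections_def)
    have qq: "q * q = q" and sq: "star q = q" using q(2) by (auto simp: projection_def)
    have pq: "p * q = q" using arg_cong[OF q(3), of star] by (simp add: star_mult sp sq)
    have "q * x = p * (q * x)" for x by (simp add: pq flip: mult.assoc)
    then have "range ((*) q) \<subseteq> range ((*) p)" by blast
    moreover have "p \<notin> range ((*) q)"
    proof
      assume "p \<in> range ((*) q)"
      then obtain x where "p = q * x" by blast
      then have "q * p = p" by (simp add: qq flip: mult.assoc)
      then show False using q(3,5) by simp
    qed
    moreover have "p \<in> range ((*) p)" using pp by (metis rangeI)
    ultimately have "range ((*) q) \<subset> range ((*) p)" by blast
    then have "complex_space.dim (range ((*) q)) < complex_space.dim (range ((*) p))"
      by (intro fd.dim_psubset)
        (simp only: complex_space.span_eq_iff[THEN iffD2, OF subspace_mult_image[OF complex_space.subspace_UNIV]])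
    then obtain r where r: "r \<in> minimal_projections A" "r * q = r"
      using less.hyps q by blast
    have "r * p = r * (q * p)" by (simp add: r(2) flip: mult.assoc)
    then have "r * p = r" by (simp add: q(3) r(2))
    then show ?thesis using r(1) by blast
  qed
qed

section \<open>Annihilating polynomials and eigenvectors\<close>

definition poly_eval :: "'a::unital_cstar_algebra \<Rightarrow> complex poly \<Rightarrow> 'a" where
  "poly_eval h P = (\<Sum>i\<le>degree P. coeff P i *\<^sub>C h ^ i)"

lemma poly_eval_eq:
  assumes "degree P \<le> n"
  shows "poly_eval h P = (\<Sum>i\<le>n. coeff P i *\<^sub>C h ^ i)"
  unfolding poly_eval_def using assms
  by (intro sum.mono_neutral_left) (auto simp: coeff_eq_0)

text \<open>Multiplying by the variable shifts the coefficients, which is multiplication by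
  \<open>h\<close> after evaluation. This is the case of multiplicativity that splits off a
  root.\<close>

lemma poly_eval_linear_factor:
  "poly_eval h ([:- z, 1:] * P) = h * poly_eval h P - z *\<^sub>C poly_eval h P"
proof -
  have eq: "[:- z, 1:] * P = pCons 0 P - smult z P" by simp
  have deg: "degree ([:- z, 1:] * P) \<le> Suc (degree P)"
    by (rule order_trans[OF degree_mult_le]) simp
  have "poly_eval h ([:- z, 1:] * P) = (\<Sum>i\<le>Suc (degree P). coeff (pCons 0 P) i *\<^sub>C h ^ i)
      - (\<Sum>i\<le>Suc (degree P). (z * coeff P i) *\<^sub>C h ^ i)"
    unfolding poly_eval_eq[OF deg]
    by (subst eq) (simp add: complex_space.scale_left_diff_distrib sum_subtractf)
  also have "(\<Sum>i\<le>Suc (degree P). coeff (pCons 0 P) i *\<^sub>C h ^ i) = h * poly_eval h P"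
    by (subst sum.atMost_Suc_shift)
       (simp add: poly_eval_def sum_distrib_left mult_scaleC_right)
  also have "(\<Sum>i\<le>Suc (degree P). (z * coeff P i) *\<^sub>C h ^ i) = z *\<^sub>C poly_eval h P"
    by (simp add: poly_eval_eq[of P "Suc (degree P)"] complex_space.scale_sum_right
        complex_space.scale_right_distrib scaleC_scaleC)
  finally show ?thesis .
qed

lemma annihilating_polynomial:
  assumes "finite_dimensional_cstar TYPE('a::unital_cstar_algebra)"
  shows "\<exists>P. P \<noteq> 0 \<and> poly_eval (h :: 'a) P = 0"
proof -
  obtain T :: "'a set" where T: "finite T" "complex_space.span T = UNIV"
    using assms by (auto simp: finite_dimensional_cstar_def)
  let ?I = "{..card T}"
  have "\<exists>c. (\<exists>i\<in>?I. c i \<noteq> 0) \<and> (\<Sum>i\<in>?I. c i *\<^sub>C h ^ i) = 0"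
  proof (cases "inj_on ((^) h) ?I")
    case True
    have "complex_space.dependent ((^) h ` ?I)"
    proof (rule ccontr)
      assume "complex_space.independent ((^) h ` ?I)"
      then have "card ((^) h ` ?I) \<le> card T"
        using complex_space.independent_span_bound[OF T(1)] T(2) by auto
      then show False using True by (simp add: card_image)
    qed
    then obtain u where u: "\<exists>v\<in>(^) h ` ?I. u v \<noteq> 0" "(\<Sum>v\<in>(^) h ` ?I. u v *\<^sub>C v) = 0"
      by (subst (asm) complex_space.dependent_finite) auto
    then show ?thesis
      using True by (intro exI[of _ "\<lambda>i. u (h ^ i)"]) (auto simp: sum.reindex)
  \<comment> \<open>If two powers of \<open>h\<close> coincide, the set of powers may well be
    independent; the relation is then the difference of the two equal powers.\<close>
  next
    case False
    then obtain i j where ij: "i \<in> ?I" "j \<in> ?I" "i \<noteq> j" "h ^ i = h ^ j"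
      by (auto simp: inj_on_def)
    define c where "c l = (if l = i then 1 else if l = j then -1 else 0 :: complex)" for l
    have "(\<Sum>l\<in>?I. c l *\<^sub>C h ^ l) = (\<Sum>l\<in>{i, j}. c l *\<^sub>C h ^ l)"
      using ij by (intro sum.mono_neutral_right) (auto simp: c_def)
    also have "\<dots> = 0" using ij by (simp add: c_def)
    finally show ?thesis using ij by (intro exI[of _ c]) (auto simp: c_def)
  qed
  then obtain c where c: "\<exists>i\<in>?I. c i \<noteq> 0" "(\<Sum>i\<in>?I. c i *\<^sub>C h ^ i) = 0" by blast
  define P where "P = (\<Sum>i\<in>?I. monom (c i) i)"
  have coeff: "coeff P i = (if i \<in> ?I then c i else 0)" for i
    by (simp add: P_def coeff_sum)
  have "degree P \<le> card T" by (rule degree_le) (simp add: coeff)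
  then have "poly_eval h P = 0" using c(2) by (simp add: poly_eval_eq coeff)
  moreover have "P \<noteq> 0" using c(1) coeff by (metis coeff_0)
  ultimately show ?thesis by blast
qed

text \<open>Split a root \<open>z\<close> off an annihilating polynomial of least degree. The
  cofactor does not annihilate \<open>h\<close>, by minimality, so its value at \<open>h\<close> is
  an eigenvector, and it lies in \<open>A\<close> as a polynomial in \<open>h\<close>.\<close>

lemma exists_eigenvector:
  assumes fd: "finite_dimensional_cstar TYPE('a::unital_cstar_algebra)"
    and A: "star_subalgebra A" and h: "(h :: 'a) \<in> A"
  obtains z y where "y \<in> A" "y \<noteq> 0" "h * y = z *\<^sub>C y"
proof -
  define n where "n = (LEAST n. \<exists>P. P \<noteq> 0 \<and> poly_eval h P = 0 \<and> degree P = n)"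
  have ex: "\<exists>n P. P \<noteq> 0 \<and> poly_eval h P = 0 \<and> degree P = n"
    using annihilating_polynomial[OF fd, of h] by blast
  obtain P where P: "P \<noteq> 0" "poly_eval h P = 0" "degree P = n"
    using LeastI_ex[OF ex] unfolding n_def by blast
  have min: "poly_eval h R \<noteq> 0" if "R \<noteq> 0" "degree R < n" for R
    using not_less_Least that unfolding n_def by blast
  have "degree P \<noteq> 0"
  proof
    assume "degree P = 0"
    then obtain a where a: "P = [:a:]" by (metis degree_eq_zeroE)
    then have "a *\<^sub>C (1::'a) = 0" using P(2) by (simp add: poly_eval_def)
    then show False using P(1) a by (simp add: complex_space.scale_eq_0_iff)
  qed
  then obtain z where "poly P z = 0"
    using fundamental_theorem_of_algebra[of P] by (auto simp: constant_degree)
  then obtain R where R: "P = [:- z, 1:] * R" by (auto simp: poly_eq_0_iff_dvd)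
  then have R0: "R \<noteq> 0" using P(1) by auto
  have "degree P = Suc (degree R)" unfolding R using R0 by (subst degree_mult_eq) auto
  then have "poly_eval h R \<noteq> 0" using min R0 P(3) by simp
  moreover have "h ^ i \<in> A" for i
    using A h by (induction i) (auto simp: star_subalgebra_def)
  then have "poly_eval h R \<in> A"
    using A unfolding poly_eval_def star_subalgebra_def
    by (intro complex_space.subspace_sum complex_space.subspace_scale) auto
  moreover have "h * poly_eval h R = z *\<^sub>C poly_eval h R"
    using P(2) unfolding R poly_eval_linear_factor by simp
  ultimately show ?thesis using that by blast
qed

section \<open>Connectedness and projections in both centers\<close>

lemma inclusion_matrix_eq_0:
  assumes fd: "finite_dimensional_cstar TYPE('a::unital_cstar_algebra)"
    and p: "(p :: 'a) \<in> N" "projection p" "p \<noteq> 0" and pq: "p * q = 0"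
  shows "inclusion_matrix N p q = 0"
  unfolding inclusion_matrix_def
proof (rule the_equality)
  have fq: "f * q = 0" if "f * p = f" for f
  proof -
    have "f * q = f * p * q" by (simp only: that)
    then show ?thesis by (simp add: mult.assoc pq)
  qed
  \<comment> \<open>A minimal projection below \<open>p\<close> has to exist, since otherwise no
    number would satisfy the description in \<open>inclusion_matrix\<close>.\<close>
  obtain f where "f \<in> minimal_projections N" "f * p = f"
    using exists_minimal_projection[OF fd p] by blast
  then show "\<exists>f\<in>minimal_projections N. f * p = f \<and>
      (\<exists>F. finite F \<and> card F = 0 \<and> F \<subseteq> minimal_projections UNIV \<and>
        (\<forall>g\<in>F. \<forall>h\<in>F. g \<noteq> h \<longrightarrow> g * h = 0) \<and> f * q = \<Sum>F)"
    using fq by (intro bexI[of _ f] conjI exI[of _ "{}"]) auto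
  fix n assume "\<exists>f\<in>minimal_projections N. f * p = f \<and>
      (\<exists>F. finite F \<and> card F = n \<and> F \<subseteq> minimal_projections UNIV \<and>
        (\<forall>g\<in>F. \<forall>h\<in>F. g \<noteq> h \<longrightarrow> g * h = 0) \<and> f * q = \<Sum>F)"
  then obtain f F where f: "f * p = f" and F: "finite F" "card F = n"
    "F \<subseteq> minimal_projections UNIV" "\<forall>g\<in>F. \<forall>h\<in>F. g \<noteq> h \<longrightarrow> g * h = 0" and fF: "f * q = \<Sum>F"
    by blast
  have sF: "\<Sum>F = 0" using fq[OF f] fF by simp
  have "F = {}"
  proof (rule ccontr)
    assume "F \<noteq> {}"
    then obtain g where g: "g \<in> F" by blast
    \<comment> \<open>Orthogonality lets multiplication by \<open>g\<close> single out one summand,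
      so a vanishing sum of nonzero orthogonal projections is empty.\<close>
    have "g * \<Sum>F = (\<Sum>h\<in>F. if h = g then g * g else 0)"
      unfolding sum_distrib_left using F(4) g by (intro sum.cong) auto
    also have "\<dots> = g" using F(1,3) g by (auto simp: minimal_projections_def projection_def)
    finally show False using F(3) sF g by (auto simp: minimal_projections_def)
  qed
  then show "n = 0" using F(2) by simp
qed

lemma minimal_central_projection_cases:
  assumes A: "star_subalgebra A" and p: "p \<in> minimal_central_projections A"
    and e: "e \<in> center A" "projection e"
  shows "p * e = p \<or> p * e = 0"
proof -
  have pA: "p \<in> center A" and pp: "p * p = p" "star p = p"
    using p by (auto simp: minimal_projections_def projection_def)
  have comm: "p * e = e * p" using center_commute[OF pA center_in[OF e(1)]] .
  have "p * e \<in> center A"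
    using star_subalgebra_center[OF A] pA e(1) by (simp add: star_subalgebra_def)
  moreover have "p * e * p = p * e" by (metis comm mult.assoc pp(1))
  moreover have "projection (p * e)"
    unfolding projection_def
  proof
    have "p * e * (p * e) = p * e * p * e" by (simp add: mult.assoc)
    also have "\<dots> = p * (e * e)" using \<open>p * e * p = p * e\<close> by (simp add: mult.assoc)
    finally show "p * e * (p * e) = p * e" using e(2) by (simp add: projection_def)
    show "star (p * e) = p * e" using e(2) pp comm by (simp add: star_mult projection_def)
  qed
  ultimately show ?thesis using p unfolding minimal_projections_def by blast
qed

text \<open>Every vertex of the diagram lies below \<open>e\<close> or below \<open>1 - e\<close>,
  and no arc crosses between the two sides. If \<open>e\<close> were neither 0 nor 1, both sides
  would contain a vertex of \<open>N\<close>, against connectedness.\<close>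

lemma connected_inclusion_projection_eq_1:
  assumes fd: "finite_dimensional_cstar TYPE('a::unital_cstar_algebra)"
    and N: "star_subalgebra (N :: 'a set)" and conn: "connected_inclusion N"
    and e: "e \<in> center N" "e \<in> center UNIV" "projection e" "e \<noteq> 0"
  shows "e = 1"
proof (rule ccontr)
  assume "e \<noteq> 1"
  have ee: "e * e = e" "star e = e" using e(3) by (auto simp: projection_def)
  have ec: "e * x = x * e" for x using center_commute[OF e(2)] by simp
  define inside where "inside = case_sum (\<lambda>p. p * e = p) (\<lambda>q. q * e = q)"
  have arc: "inside (Inl p) = inside (Inr q)"
    if p: "p \<in> minimal_central_projections N" and q: "q \<in> minimal_central_projections UNIV"
      and k: "k < inclusion_matrix N p q" for p q k
  proof -
    have "p \<in> N" "projection p" "p \<noteq> 0"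
      using p center_in by (auto simp: minimal_projections_def)
    \<comment> \<open>Along an arc \<open>p * q\<close> is nonzero. As \<open>e\<close> commutes
      with \<open>q\<close>, it cannot fix one of \<open>p\<close>, \<open>q\<close> and kill the
      other without forcing this product to be 0.\<close>
    then have "p * q \<noteq> 0" using inclusion_matrix_eq_0[OF fd] k by (metis not_less_zero)
    moreover have "p * e * q = p * (q * e)" using ec[of q] by (simp add: mult.assoc)
    moreover have "p * e = p \<or> p * e = 0"
      using minimal_central_projection_cases[OF N p e(1,3)] .
    moreover have "q * e = q \<or> q * e = 0"
      using minimal_central_projection_cases[OF star_subalgebra_UNIV q e(2,3)] .
    ultimately show ?thesis by (auto simp: inside_def)
  qed
  have inside_eq: "inside u = inside v"
    if "u \<in> verts (bratteli_diagram N)" "v \<in> verts (bratteli_diagram N)" for u v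
  proof -
    have "(u, v) \<in> rtrancl_on (verts (bratteli_diagram N)) (parcs (mk_symmetric (bratteli_diagram N)))"
      using conn that
      by (auto simp: connected_inclusion_def Digraph_Component.connected_def strongly_connected_def
          reachable_def)
    then show ?thesis
    proof induction
      case base
      show ?case ..
    next
      case (step x y)
      then show ?case using arc by (auto simp: parcs_mk_symmetric bratteli_diagram_def)
    qed
  qed
  have "1 \<in> center N" "complex_space.subspace (center N)"
    using star_subalgebra_center[OF N] by (auto simp: star_subalgebra_def)
  then have "1 - e \<in> center N" using e(1) complex_space.subspace_diff by blast
  moreover have "projection (1 - e)"
    by (simp add: projection_def star_diff ee left_diff_distrib right_diff_distrib)
  ultimately obtain p where p: "p \<in> minimal_central_projections N" "p * (1 - e) = p"
    using exists_minimal_projection[OF fd, of "1 - e" "center N"] \<open>e \<noteq> 1\<close> by auto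
  obtain p' where p': "p' \<in> minimal_central_projections N" "p' * e = p'"
    using exists_minimal_projection[OF fd e(1,3,4)] by blast
  have "p * e = p"
    using inside_eq[of "Inl p" "Inl p'"] p(1) p' by (auto simp: inside_def bratteli_diagram_def)
  then have "p = 0" using p(2) by (simp add: right_diff_distrib)
  then show False using p(1) by (simp add: minimal_projections_def)
qed

section \<open>Frames and conditional expectations\<close>

locale finite_dimensional_trace =
  fixes tr :: "'a::unital_cstar_algebra \<Rightarrow> complex"
  assumes fin_dim: "finite_dimensional_cstar TYPE('a)"
    and faithful_trace: "faithful_tracial_state tr"
begin

lemma tr_linear: "Vector_Spaces.linear scaleC (*) tr"
  using faithful_trace by (simp add: faithful_tracial_state_def)

lemma tr_add [simp]: "tr (x + y) = tr x + tr y"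
  and tr_scaleC [simp]: "tr (c *\<^sub>C x) = c * tr x"
  using tr_linear by (auto simp: Vector_Spaces.linear_def module_hom_def module_hom_axioms_def)

lemma tr_zero [simp]: "tr 0 = 0"
  using tr_scaleC[of 0 0] by simp

lemma tr_diff [simp]: "tr (x - y) = tr x - tr y"
  by (metis add_diff_cancel_right' diff_add_cancel tr_add)

lemma tr_sum: "tr (sum f I) = (\<Sum>i\<in>I. tr (f i))"
  by (induction I rule: infinite_finite_induct) auto

lemma tr_one [simp]: "tr 1 = 1"
  and tr_nonneg: "tr (star x * x) \<in> \<real>\<^sub>\<ge>\<^sub>0"
  and tr_faithful: "tr (star x * x) = 0 \<Longrightarrow> x = 0"
  and tr_commute: "tr (x * y) = tr (y * x)"
  using faithful_trace by (auto simp: faithful_tracial_state_def)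

lemma Re_tr_nonneg: "0 \<le> Re (tr (star x * x))"
  using tr_nonneg[of x] by (auto simp: nonneg_Reals_def)

text \<open>Polarization: \<open>tr (star y * y)\<close> is real for \<open>y = x + 1\<close> and
  \<open>y = x + \<i> *\<^sub>C 1\<close>, which compares the imaginary and the real parts
  respectively.\<close>

lemma tr_star: "tr (star x) = cnj (tr x)"
proof -
  have real: "Im (tr (star y * y)) = 0" for y
    using tr_nonneg[of y] by (auto simp: nonneg_Reals_def)
  have "Im (tr x) + Im (tr (star x)) = 0"
    using real[of "x + 1"] real[of x] by (simp add: star_add distrib_left distrib_right)
  moreover have "Re (tr x) - Re (tr (star x)) = 0"
    using real[of "x + \<i> *\<^sub>C 1"] real[of x]
    by (simp add: star_add star_scaleC distrib_left left_diff_distrib mult_scaleC_left mult_scaleC_right)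
  ultimately show ?thesis by (simp add: complex_eq_iff)
qed

lemma tr_nondegenerate:
  assumes "\<And>x. tr (x * y) = tr (x * z)"
  shows "y = z"
  using tr_faithful[of "y - z"] assms[of "star (y - z)"] by (simp add: right_diff_distrib)

text \<open>An orthonormal basis satisfies this condition; only the expansion property is ever needed.\<close>

definition frame :: "'a set \<Rightarrow> 'a set \<Rightarrow> bool" where
  "frame V F \<longleftrightarrow> finite F \<and> F \<subseteq> V \<and> (\<forall>x\<in>V. (\<Sum>u\<in>F. tr (star u * x) *\<^sub>C u) = x)"

text \<open>For a frame \<open>F\<close> of \<open>V\<close> this is the orthogonal projection of
  the L2 space onto \<open>V\<close>; for \<open>V = N\<close> it is the trace preserving
  conditional expectation.\<close>

definition frame_proj :: "'a set \<Rightarrow> 'a \<Rightarrow> 'a" where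
  "frame_proj F x = (\<Sum>u\<in>F. tr (star u * x) *\<^sub>C u)"

lemma frameD:
  assumes "frame V F"
  shows frame_finite: "finite F"
    and frame_subset: "u \<in> F \<Longrightarrow> u \<in> V"
    and frame_expand: "x \<in> V \<Longrightarrow> (\<Sum>u\<in>F. tr (star u * x) *\<^sub>C u) = x"
  using assms by (auto simp: frame_def)

lemma frame_expand_star:
  assumes "frame V F" "star x \<in> V"
  shows "(\<Sum>u\<in>F. tr (x * u) *\<^sub>C star u) = x"
proof -
  have "x = star (\<Sum>u\<in>F. tr (star u * star x) *\<^sub>C u)"
    using frame_expand[OF assms] by (simp add: star_star)
  also have "\<dots> = (\<Sum>u\<in>F. tr (x * u) *\<^sub>C star u)"
    by (simp add: star_sum star_scaleC flip: tr_star star_mult) (simp add: star_star)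
  finally show ?thesis by simp
qed

lemma frame_proj_in:
  "frame V F \<Longrightarrow> complex_space.subspace V \<Longrightarrow> frame_proj F x \<in> V"
  unfolding frame_proj_def
  by (intro complex_space.subspace_sum complex_space.subspace_scale) (auto dest: frame_subset)

lemma frame_proj_orth:
  assumes "frame V F" "y \<in> V"
  shows "tr (star y * frame_proj F x) = tr (star y * x)"
proof -
  have "tr (star y * x) = tr ((\<Sum>u\<in>F. tr (star y * u) *\<^sub>C star u) * x)"
    using frame_expand_star[OF assms(1), of "star y"] assms(2) by (simp add: star_star)
  then show ?thesis
    by (simp add: frame_proj_def sum_distrib_left sum_distrib_right tr_sum mult_scaleC_left
        mult_scaleC_right mult.commute)
qed

text \<open>One Gram-Schmidt step: the residue \<open>r\<close> of \<open>b\<close> is orthogonal to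
  the old span. Either it vanishes and the span is unchanged, or its normalization \<open>g\<close>
  joins the frame.\<close>

lemma frame_insert:
  assumes F: "frame (complex_space.span B) F"
  shows "\<exists>F'. frame (complex_space.span (insert b B)) F'"
proof -
  let ?V = "complex_space.span B"
  define r where "r = b - frame_proj F b"
  have Fb: "frame_proj F b \<in> ?V"
    using frame_proj_in[OF F] by (simp add: complex_space.subspace_span)
  have orth: "tr (star y * r) = 0" if "y \<in> ?V" for y
    using frame_proj_orth[OF F that] by (simp add: r_def right_diff_distrib)
  have orth': "tr (star r * y) = 0" if "y \<in> ?V" for y
    using arg_cong[OF orth[OF that], of cnj] by (simp flip: tr_star add: star_mult star_star)
  have split: "\<exists>y\<in>?V. \<exists>c. x = y + c *\<^sub>C r" if x: "x \<in> complex_space.span (insert b B)" for x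
  proof -
    obtain c where "x - c *\<^sub>C b \<in> ?V"
      using x complex_space.span_breakdown_eq by blast
    then have "x - c *\<^sub>C b + c *\<^sub>C frame_proj F b \<in> ?V"
      by (intro complex_space.span_add complex_space.span_scale Fb)
    moreover have "x = (x - c *\<^sub>C b + c *\<^sub>C frame_proj F b) + c *\<^sub>C r"
      by (simp add: r_def complex_space.scale_right_diff_distrib)
    ultimately show ?thesis by blast
  qed
  have mono: "?V \<subseteq> complex_space.span (insert b B)"
    by (intro complex_space.span_mono) auto
  show ?thesis
  proof (cases "r = 0")
    case True
    then have "complex_space.span (insert b B) = ?V"
      using split mono by fastforce
    then show ?thesis using F by auto
  next
    case False
    define s where "s = Re (tr (star r * r))"
    have "s > 0" and s: "tr (star r * r) = of_real s"
      using tr_nonneg[of r] tr_faithful[of r] False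
      by (auto simp: s_def nonneg_Reals_def order_less_le)
    define g where "g = complex_of_real (1 / sqrt s) *\<^sub>C r"
    \<comment> \<open>Frames are sets, so the new term contributes to the sum only if
      \<open>g\<close> is not already a member.\<close>
    have gF: "g \<notin> F"
    proof
      assume "g \<in> F"
      then have "tr (star g * r) = 0" using frame_subset[OF F] orth by blast
      then show False using s \<open>s > 0\<close>
        by (simp add: g_def star_scaleC mult_scaleC_left)
    qed
    have gr: "tr (star g * r) *\<^sub>C g = r"
    proof -
      have "1 / sqrt s * s * (1 / sqrt s) = 1"
        using \<open>s > 0\<close> by (simp add: real_div_sqrt)
      then have "complex_of_real (1 / sqrt s) * of_real s * of_real (1 / sqrt s) = 1"
        by (metis of_real_1 of_real_mult)
      then show ?thesis
        unfolding g_def star_scaleC mult_scaleC_left tr_scaleC s scaleC_scaleC complex_cnj_complex_of_real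
        by simp
    qed
    have "(\<Sum>u\<in>insert g F. tr (star u * x) *\<^sub>C u) = x"
      if x: "x \<in> complex_space.span (insert b B)" for x
    proof -
      obtain y c where y: "y \<in> ?V" "x = y + c *\<^sub>C r" using split[OF x] by blast
      have "tr (star g * x) = c * tr (star g * r)"
        using orth'[OF y(1)]
        by (simp add: y(2) distrib_left mult_scaleC_right g_def star_scaleC mult_scaleC_left)
      moreover have "tr (star u * x) = tr (star u * y)" if "u \<in> F" for u
        using orth[OF frame_subset[OF F that]] by (simp add: y(2) distrib_left mult_scaleC_right)
      ultimately show ?thesis
        using gF frame_finite[OF F] frame_expand[OF F y(1)] y(2) gr
        by (simp flip: scaleC_scaleC)
    qed
    moreover have "g \<in> complex_space.span (insert b B)"
      unfolding g_def r_def using Fb mono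
      by (intro complex_space.span_scale complex_space.span_diff) (auto intro: complex_space.span_base)
    ultimately have "frame (complex_space.span (insert b B)) (insert g F)"
      using F mono unfolding frame_def by blast
    then show ?thesis ..
  qed
qed

lemma frame_exists:
  assumes "complex_space.subspace V"
  obtains F where "frame V F"
proof -
  have "\<exists>F. frame (complex_space.span B) F" if "finite B" for B
    using that
  proof (induction B)
    case empty
    have "frame (complex_space.span {}) {}" by (simp add: frame_def)
    then show ?case ..
  next
    case (insert b B)
    then show ?case using frame_insert by blast
  qed
  then show ?thesis
    using finite_dimensional_basis[OF fin_dim assms] that by metis
qed

text \<open>The tensor of all \<open>u\<close> with \<open>star u\<close> is a Casimir element:
  expand \<open>x * u\<close> in the frame, swap the sums, and the dual expansion recollects
  \<open>star t * x\<close> on the other side.\<close>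

lemma frame_sum_commute:
  assumes "frame A F" "star_subalgebra A" "x \<in> A"
  shows "x * (\<Sum>u\<in>F. u * y * star u) = (\<Sum>u\<in>F. u * y * star u) * x"
proof -
  have "x * (\<Sum>u\<in>F. u * y * star u) = (\<Sum>u\<in>F. (x * u) * y * star u)"
    by (simp add: sum_distrib_left mult.assoc)
  also have "\<dots> = (\<Sum>u\<in>F. (\<Sum>t\<in>F. tr (star t * (x * u)) *\<^sub>C t) * y * star u)"
    using assms frame_subset[OF assms(1)]
    by (intro sum.cong refl) (simp add: frame_expand[OF assms(1)] star_subalgebra_def)
  also have "\<dots> = (\<Sum>t\<in>F. \<Sum>u\<in>F. t * y * (tr ((star t * x) * u) *\<^sub>C star u))"
    by (simp add: sum_distrib_right mult_scaleC_left mult_scaleC_right mult.assoc) (rule sum.swap)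
  also have "\<dots> = (\<Sum>t\<in>F. t * y * (star t * x))"
    using assms frame_subset[OF assms(1)]
    by (intro sum.cong refl)
       (simp add: frame_expand_star[OF assms(1)] star_mult star_star star_subalgebra_def
         flip: sum_distrib_left)
  finally show ?thesis by (simp add: sum_distrib_right mult.assoc)
qed

text \<open>Expanding \<open>star u\<close> gives the coefficients
  \<open>tr (star t * star u)\<close>, which are symmetric in \<open>t\<close> and \<open>u\<close>
  because \<open>tr\<close> is a trace.\<close>

lemma frame_sum_star:
  assumes "frame A F" "star_subalgebra A"
  shows "(\<Sum>u\<in>F. star u * u) = (\<Sum>u\<in>F. u * star u)"
proof -
  have st: "star u \<in> A" if "u \<in> F" for u
    using assms frame_subset[OF assms(1) that] by (simp add: star_subalgebra_def)
  have "(\<Sum>u\<in>F. star u * u) = (\<Sum>u\<in>F. (\<Sum>t\<in>F. tr (star t * star u) *\<^sub>C t) * u)"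
    by (intro sum.cong refl) (simp add: frame_expand[OF assms(1)] st)
  also have "\<dots> = (\<Sum>t\<in>F. t * (\<Sum>u\<in>F. tr (star u * star t) *\<^sub>C u))"
    by (simp add: sum_distrib_right sum_distrib_left mult_scaleC_left mult_scaleC_right)
      (subst sum.swap, intro sum.cong refl arg_cong2[of _ _ _ _ scaleC] tr_commute)
  also have "\<dots> = (\<Sum>u\<in>F. u * star u)"
    by (intro sum.cong refl) (simp add: frame_expand[OF assms(1)] st)
  finally show ?thesis .
qed

text \<open>The trace is the sum of the squared L2 norms of the elements \<open>star u * x\<close>,
  so each of them vanishes.\<close>

lemma frame_sum_faithful:
  assumes "finite F" "tr (star x * (\<Sum>u\<in>F. u * star u) * x) = 0" "u \<in> F"
  shows "star u * x = 0"
proof -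
  have "(\<Sum>u\<in>F. tr (star (star u * x) * (star u * x))) = 0"
    using assms(2) by (simp add: sum_distrib_left sum_distrib_right tr_sum star_mult star_star mult.assoc)
  then have "(\<Sum>u\<in>F. Re (tr (star (star u * x) * (star u * x)))) = 0"
    by (metis Re_sum zero_complex.sel(1))
  then have "Re (tr (star (star u * x) * (star u * x))) = 0"
    using assms(1,3) Re_tr_nonneg by (subst (asm) sum_nonneg_eq_0_iff) auto
  then show ?thesis
    using tr_nonneg[of "star u * x"] by (intro tr_faithful) (auto simp: nonneg_Reals_def)
qed

text \<open>The inverse of the sum \<open>c\<close> comes from projecting 1 orthogonally onto the
  ideal \<open>c A\<close>. The residue vanishes because \<open>c\<close> is a faithful positive
  element.\<close>

lemma frame_sum_inverse:
  assumes F: "frame A F" and A: "star_subalgebra A"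
  obtains w where "w \<in> center A" "star w = w" "w * (\<Sum>u\<in>F. u * star u) = 1"
    "(\<Sum>u\<in>F. u * star u) * w = 1"
proof -
  define c where "c = (\<Sum>u\<in>F. u * star u)"
  have sub: "complex_space.subspace A" using A by (simp add: star_subalgebra_def)
  have cA: "c \<in> A" unfolding c_def
    using A frame_subset[OF F] sub
    by (intro complex_space.subspace_sum) (auto simp: star_subalgebra_def)
  have comm: "x * c = c * x" if "x \<in> A" for x
    using frame_sum_commute[OF F A that, of 1] by (simp add: c_def)
  have sc: "star c = c" by (simp add: c_def star_sum star_mult star_star)
  have "complex_space.subspace ((*) c ` A)" by (rule subspace_mult_image[OF sub])
  then obtain H where H: "frame ((*) c ` A) H" and sH: "complex_space.subspace ((*) c ` A)"
    using frame_exists by blast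
  obtain w where w: "w \<in> A" "frame_proj H 1 = c * w"
    using frame_proj_in[OF H sH] by blast
  define r where "r = 1 - c * w"
  have rA: "r \<in> A" unfolding r_def
    using A cA w sub by (intro complex_space.subspace_diff) (auto simp: star_subalgebra_def)
  \<comment> \<open>The residue \<open>r\<close> is orthogonal to the ideal; the vector
    \<open>c * r\<close> of the ideal is the one that produces
    \<open>tr (star r * c * r)\<close>.\<close>
  have "tr (star (c * r) * (1 - c * w)) = 0"
    using frame_proj_orth[OF H, of "c * r" 1] rA w by (simp add: right_diff_distrib)
  then have "tr (star r * c * r) = 0"
    by (simp add: star_mult sc r_def)
  then have "star u * r = 0" if "u \<in> F" for u
    using frame_sum_faithful[OF frame_finite[OF F] _ that] by (simp add: c_def)
  then have "r = 0" using frame_expand[OF F rA] by simp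
  then have cw: "c * w = 1" by (simp add: r_def)
  have wc: "w * c = 1" using comm[OF w(1)] cw by simp
  have "w * x = x * w" if "x \<in> A" for x
  proof -
    have "w * x = w * (x * c) * w" by (simp add: mult.assoc cw)
    also have "\<dots> = (w * c) * x * w" by (simp add: comm[OF that] mult.assoc)
    finally show ?thesis by (simp add: wc)
  qed
  then have "w \<in> center A" using w by (intro centerI)
  moreover have "star w = w"
  proof -
    have "star w * c = 1" using arg_cong[OF cw, of star] by (simp add: star_mult sc)
    then have "w = (star w * c) * w" by simp
    also have "\<dots> = star w * (c * w)" by (rule mult.assoc)
    finally show ?thesis by (simp add: cw)
  qed
  ultimately show ?thesis using that wc cw by (simp add: c_def)
qed

section \<open>The conditional expectation onto \<open>N\<close> and the Markov property\<close>

context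
  fixes N G
  assumes N: "star_subalgebra N" and G: "frame N G"
begin

lemma cond_exp_in: "frame_proj G x \<in> N"
  using frame_proj_in[OF G] N by (simp add: star_subalgebra_def)

lemma tr_cond_exp_left: "y \<in> N \<Longrightarrow> tr (y * frame_proj G x) = tr (y * x)"
  using frame_proj_orth[OF G, of "star y" x] N by (simp add: star_subalgebra_def star_star)

lemma cond_exp_unique:
  assumes "z \<in> N" "\<And>y. y \<in> N \<Longrightarrow> tr (y * z) = tr (y * x)"
  shows "frame_proj G x = z"
proof -
  have d: "frame_proj G x - z \<in> N"
    using cond_exp_in assms(1) N complex_space.subspace_diff by (auto simp: star_subalgebra_def)
  then have "star (frame_proj G x - z) \<in> N" using N by (simp add: star_subalgebra_def)
  then have "tr (star (frame_proj G x - z) * (frame_proj G x - z)) = 0"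
    using assms(2) tr_cond_exp_left by (simp add: right_diff_distrib)
  then show ?thesis using tr_faithful by force
qed

lemma tr_cond_exp_symmetric: "tr (y * frame_proj G x) = tr (frame_proj G y * x)"
  by (metis cond_exp_in tr_commute tr_cond_exp_left)

text \<open>The expectation is \<open>N\<close>-linear on both sides, so the element
  \<open>h * n\<close>, which equals \<open>n * h\<close>, is sent to the product of
  \<open>n\<close> with the image of \<open>h\<close> in either order.\<close>

lemma cond_exp_center:
  assumes "h \<in> center UNIV"
  shows "frame_proj G h \<in> center N"
proof -
  have "frame_proj G h * n = n * frame_proj G h" if n: "n \<in> N" for n
  proof -
    have mult: "x * y \<in> N" if "x \<in> N" "y \<in> N" for x y
      using N that by (simp add: star_subalgebra_def)
    have hc: "h * x = x * h" for x using center_commute[OF assms] by simp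
    have "frame_proj G (h * n) = frame_proj G h * n"
    proof (rule cond_exp_unique)
      fix y assume y: "y \<in> N"
      have "tr (y * (frame_proj G h * n)) = tr ((n * y) * frame_proj G h)"
        by (metis mult.assoc tr_commute)
      also have "\<dots> = tr ((n * y) * h)" using tr_cond_exp_left mult[OF n y] by blast
      also have "\<dots> = tr (y * (h * n))" by (metis mult.assoc tr_commute)
      finally show "tr (y * (frame_proj G h * n)) = tr (y * (h * n))" .
    qed (use n mult cond_exp_in in auto)
    moreover have "frame_proj G (h * n) = n * frame_proj G h"
    proof (rule cond_exp_unique)
      fix y assume y: "y \<in> N"
      show "tr (y * (n * frame_proj G h)) = tr (y * (h * n))"
        using tr_cond_exp_left[OF mult[OF y n]] by (simp add: mult.assoc hc[of n])
    qed (use n mult cond_exp_in in auto)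
    ultimately show ?thesis by simp
  qed
  then show ?thesis using cond_exp_in by (intro centerI)
qed

lemma cond_exp_star:
  "star (frame_proj G x) = frame_proj G (star x)"
proof -
  have "frame_proj G (star x) = star (frame_proj G x)"
  proof (rule cond_exp_unique)
    show "star (frame_proj G x) \<in> N" using cond_exp_in N by (simp add: star_subalgebra_def)
    fix y assume y: "y \<in> N"
    then have sy: "star y \<in> N" using N by (simp add: star_subalgebra_def)
    have "tr (y * star z) = cnj (tr (star y * z))" for z
      by (metis star_mult star_star tr_commute tr_star)
    then show "tr (y * star (frame_proj G x)) = tr (y * star x)"
      using tr_cond_exp_left[OF sy] by simp
  qed
  then show ?thesis by simp
qed

text \<open>This replaces the definite description by an explicit finite sum, through which the
  basic construction is computed.\<close>

lemma jones_projection_eq: "jones_projection N tr = frame_proj G"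
proof
  fix x
  show "jones_projection N tr x = frame_proj G x"
    unfolding jones_projection_def
  proof (rule the_equality)
    show "frame_proj G x \<in> N \<and> (\<forall>y\<in>N. l2_inner tr (x - frame_proj G x) y = 0)"
      using cond_exp_in frame_proj_orth[OF G] by (simp add: l2_inner_def right_diff_distrib)
    fix z assume z: "z \<in> N \<and> (\<forall>y\<in>N. l2_inner tr (x - z) y = 0)"
    have "frame_proj G x = z"
    proof (rule cond_exp_unique)
      fix y assume "y \<in> N"
      then have "star y \<in> N" using N by (simp add: star_subalgebra_def)
      then have "tr (star (star y) * (x - z)) = 0" using z by (simp add: l2_inner_def)
      then show "tr (y * z) = tr (y * x)" by (simp add: star_star right_diff_distrib)
    qed (use z in auto)
    then show "z = frame_proj G x" by simp
  qed
qed

text \<open>\<open>u w\<close> and \<open>u\<^sup>*\<close> behave like a Pimsner--Popa basis of \<open>M\<close> over \<open>N\<close> and its dual.\<close>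

lemma frame_reconstruction:
  assumes F: "frame UNIV F" and w: "w \<in> center N" "w * (\<Sum>v\<in>G. v * star v) = 1"
  shows "(\<Sum>u\<in>F. u * w * frame_proj G (star u * x)) = x"
proof -
  have "(\<Sum>u\<in>F. u * w * frame_proj G (star u * x))
      = (\<Sum>v\<in>G. (\<Sum>u\<in>F. tr (star v * (star u * x)) *\<^sub>C u) * (w * v))"
    by (simp add: frame_proj_def sum_distrib_left sum_distrib_right mult_scaleC_left
        mult_scaleC_right mult.assoc) (rule sum.swap)
  \<comment> \<open>Cyclicity moves \<open>star v\<close> to the right of \<open>x\<close>, so that
    the sum over \<open>F\<close> becomes the expansion of \<open>x * star v\<close>.\<close>
  also have "\<dots> = (\<Sum>v\<in>G. (\<Sum>u\<in>F. tr (star u * (x * star v)) *\<^sub>C u) * (w * v))"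
    using tr_commute by (intro sum.cong refl arg_cong2[of _ _ _ _ "(*)"] arg_cong2[of _ _ _ _ scaleC])
      (metis mult.assoc)
  also have "\<dots> = (\<Sum>v\<in>G. x * star v * (w * v))"
    by (simp add: frame_expand[OF F])
  also have "\<dots> = (\<Sum>v\<in>G. x * (star v * v) * w)"
    using center_commute[OF w(1) frame_subset[OF G]]
    by (intro sum.cong refl) (simp add: mult.assoc)
  also have "\<dots> = x * ((\<Sum>v\<in>G. star v * v) * w)"
    by (simp add: sum_distrib_left sum_distrib_right mult.assoc)
  also have "(\<Sum>v\<in>G. star v * v) * w = w * (\<Sum>v\<in>G. star v * v)"
  proof (rule center_commute[OF w(1), symmetric])
    show "(\<Sum>v\<in>G. star v * v) \<in> N"
      using N frame_subset[OF G]
      by (intro complex_space.subspace_sum) (auto simp: star_subalgebra_def)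
  qed
  also have "\<dots> = 1" using w(2) frame_sum_star[OF G N] by simp
  finally show ?thesis by simp
qed

text \<open>By \<open>frame_reconstruction\<close>, left multiplication by \<open>y\<close> is a sum
  of operators y u w e u*, with e the Jones projection. Taking \<open>Tr\<close> and moving u* to
  the front turns the Markov property into an identity of traces against every
  \<open>y\<close>.\<close>

lemma markov_index:
  assumes markov: "markov_trace_of_modulus N tr \<tau>" and F: "frame UNIV F"
    and w: "w \<in> center N" "w * (\<Sum>v\<in>G. v * star v) = 1"
  shows "of_real \<tau> *\<^sub>C (\<Sum>u\<in>F. u * w * star u) = 1"
proof -
  let ?B = "basic_construction N tr"
  let ?E = "frame_proj G"
  obtain Tr where Tr: "positive_trace_on_basic_construction N tr Tr"
    "\<And>x. Tr ((*) x) = tr x" "\<And>x. Tr ((*) x \<circ> ?E) = of_real \<tau> * tr x"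
    using markov by (auto simp: markov_trace_of_modulus_def jones_projection_eq)
  note in_B = basic_construction.intros(1-5)[where N = N and tr = tr, unfolded jones_projection_eq]
  have Tr_add: "Tr (\<lambda>x. S x + T x) = Tr S + Tr T" if "S \<in> ?B" "T \<in> ?B" for S T
    using Tr(1) that by (simp add: positive_trace_on_basic_construction_def)
  have Tr_comm: "Tr (S \<circ> T) = Tr (T \<circ> S)" if "S \<in> ?B" "T \<in> ?B" for S T
    using Tr(1) that by (simp add: positive_trace_on_basic_construction_def)
  have zero: "(\<lambda>x. 0) = ((*) 0 :: 'a \<Rightarrow> 'a)" by auto
  have Tr_sum: "(\<lambda>x. \<Sum>i\<in>I. T i x) \<in> ?B \<and> Tr (\<lambda>x. \<Sum>i\<in>I. T i x) = (\<Sum>i\<in>I. Tr (T i))"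
    if "finite I" "\<And>i. i \<in> I \<Longrightarrow> T i \<in> ?B" for I :: "'a set" and T
    using that
  proof (induction I)
    case empty
    then show ?case using in_B(1)[of 0] Tr(2)[of 0] by (simp add: zero)
  next
    case (insert i I)
    then show ?case using in_B(3)[of "T i" "\<lambda>x. \<Sum>i\<in>I. T i x"] Tr_add by simp
  qed
  define T where "T y u = (*) (y * u * w) \<circ> ?E \<circ> (*) (star u)" for y u
  have TB: "T y u \<in> ?B" for y u unfolding T_def by (intro in_B)
  have Tr_T: "Tr (T y u) = of_real \<tau> * tr (y * (u * w * star u))" for y u
  proof -
    have "Tr (T y u) = Tr ((*) (star u) \<circ> ((*) (y * u * w) \<circ> ?E))"
      unfolding T_def by (intro Tr_comm in_B)
    also have "(*) (star u) \<circ> ((*) (y * u * w) \<circ> ?E) = (*) (star u * (y * u * w)) \<circ> ?E"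
      by (auto simp: mult.assoc)
    also have "Tr \<dots> = of_real \<tau> * tr (y * (u * w * star u))"
      by (simp add: Tr(3)) (simp add: tr_commute[of "star u"] mult.assoc)
    finally show ?thesis .
  qed
  show ?thesis
  proof (rule tr_nondegenerate)
    fix y
    have "(*) y = (\<lambda>x. \<Sum>u\<in>F. T y u x)"
    proof
      fix x
      have "y * x = y * (\<Sum>u\<in>F. u * w * ?E (star u * x))"
        using frame_reconstruction[OF F w] by simp
      then show "y * x = (\<Sum>u\<in>F. T y u x)" by (simp add: T_def sum_distrib_left mult.assoc)
    qed
    then have "tr y = (\<Sum>u\<in>F. Tr (T y u))"
      using Tr_sum[OF frame_finite[OF F] TB] Tr(2)[of y] by simp
    then show "tr (y * of_real \<tau> *\<^sub>C (\<Sum>u\<in>F. u * w * star u)) = tr (y * 1)"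
      by (simp add: Tr_T mult_scaleC_right sum_distrib_left tr_sum)
  qed
qed

text \<open>Here \<open>a'\<close>, \<open>b'\<close> reconstruct through the conditional expectation \<open>E'\<close> of the trace with density
  \<open>h\<close>, and \<open>k\<close> is the density of that trace on \<open>N\<close>.\<close>

lemma density_transfer:
  assumes "\<And>x. (\<Sum>i\<in>I. a i * frame_proj G (b i * x)) = x"
    and "\<And>x. (\<Sum>j\<in>J. a' j * E' (b' j * x)) = x"
    and E': "\<And>y. E' y * k = frame_proj G (h * y)"
    and h: "h \<in> center UNIV"
  shows "(\<Sum>i\<in>I. a i * k * b i) = (\<Sum>j\<in>J. a' j * b' j) * h"
proof (rule tr_nondegenerate)
  fix x
  have cyc: "tr (p * q * r * s) = tr (s * (p * q * r))" for p q r s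
    by (simp add: tr_commute)
  have "tr (x * (\<Sum>i\<in>I. a i * k * b i)) = (\<Sum>i\<in>I. tr (b i * x * a i * k))"
    by (simp add: sum_distrib_left tr_sum) (intro sum.cong refl, metis mult.assoc tr_commute)
  \<comment> \<open>Rewrite each \<open>a i\<close> by the second reconstruction; the first one will
    later absorb the sum over \<open>I\<close>.\<close>
  also have "\<dots> = (\<Sum>i\<in>I. tr (b i * x * (\<Sum>j\<in>J. a' j * E' (b' j * a i)) * k))"
    by (simp add: assms(2))
  also have "\<dots> = (\<Sum>i\<in>I. \<Sum>j\<in>J. tr (b i * x * a' j * frame_proj G (h * (b' j * a i))))"
    by (simp add: sum_distrib_left sum_distrib_right tr_sum mult.assoc flip: E')
  \<comment> \<open>Symmetry of the expectation under the trace carries it over to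
    \<open>b i * (x * a' j)\<close>, the form to which the first reconstruction applies.\<close>
  also have "\<dots> = (\<Sum>i\<in>I. \<Sum>j\<in>J. tr (h * b' j * (a i * frame_proj G (b i * (x * a' j)))))"
  proof (intro sum.cong refl)
    fix i j
    show "tr (b i * x * a' j * frame_proj G (h * (b' j * a i)))
        = tr (h * b' j * (a i * frame_proj G (b i * (x * a' j))))"
      by (subst tr_cond_exp_symmetric, subst tr_commute) (simp add: mult.assoc)
  qed
  also have "\<dots> = (\<Sum>j\<in>J. tr (h * b' j * (\<Sum>i\<in>I. a i * frame_proj G (b i * (x * a' j)))))"
    by (subst sum.swap) (simp add: sum_distrib_left tr_sum)
  also have "\<dots> = (\<Sum>j\<in>J. tr (h * b' j * (x * a' j)))"
    by (simp add: assms(1))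
  also have "\<dots> = tr (x * ((\<Sum>j\<in>J. a' j * b' j) * h))"
  proof -
    have "tr (h * b' j * (x * a' j)) = tr (x * (a' j * b' j * h))" for j
    proof -
      have "h * y = y * h" for y using center_commute[OF h] by simp
      then have "h * b' j * (x * a' j) = b' j * (x * a' j * h)" by (metis mult.assoc)
      then have "tr (h * b' j * (x * a' j)) = tr ((x * a' j * h) * b' j)"
        using tr_commute by simp
      also have "(x * a' j * h) * b' j = x * (a' j * b' j * h)"
        using \<open>\<And>y. h * y = y * h\<close>[of "b' j"] by (simp add: mult.assoc)
      finally show ?thesis .
    qed
    then show ?thesis by (simp add: sum_distrib_left sum_distrib_right tr_sum)
  qed
  finally show "tr (x * (\<Sum>i\<in>I. a i * k * b i)) = tr (x * ((\<Sum>j\<in>J. a' j * b' j) * h))" .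
qed

text \<open>Hypotheses \<open>one\<close> and \<open>harm\<close> say that \<open>1\<close> and \<open>h\<close> are fixed by an operator that is symmetric for
  a suitable weight; the Dirichlet form of \<open>h\<close> is \<open>tr (w (h - E h)\<^sup>2)\<close>, which therefore vanishes.\<close>

lemma harmonic_in_subalgebra:
  assumes F: "frame UNIV F"
    and w: "w \<in> center N" "star w = w" "w * (\<Sum>v\<in>G. v * star v) = 1" "(\<Sum>v\<in>G. v * star v) * w = 1"
    and h: "h \<in> center UNIV" "star h = h"
    and one: "t *\<^sub>C (\<Sum>u\<in>F. u * w * star u) = 1"
    and harm: "t *\<^sub>C (\<Sum>u\<in>F. u * (w * frame_proj G h) * star u) = h"
  shows "h \<in> N"
proof -
  define k where "k = frame_proj G h"
  define C where "C = (\<Sum>u\<in>F. u * star u)"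
  \<comment> \<open>The inverse \<open>c\<close> of \<open>C\<close> serves as the weight: by
    \<open>Q\<close>, pairing the averaged \<open>y\<close> with \<open>z * c\<close> amounts to
    pairing \<open>y\<close> with \<open>z\<close>.\<close>
  obtain c where c: "c \<in> center UNIV" "c * C = 1"
    using frame_sum_inverse[OF F star_subalgebra_UNIV] unfolding C_def by metis
  have kN: "k \<in> center N" using cond_exp_center[OF h(1)] by (simp add: k_def)
  have sk: "star k = k" by (simp add: k_def cond_exp_star h(2))
  have hc: "h * x = x * h" and cc: "c * x = x * c" for x
    using center_commute[OF h(1)] center_commute[OF c(1)] by auto
  have wk: "w * k = k * w" using center_commute[OF w(1) center_in[OF kN]] .
  have t0: "t \<noteq> 0" using one by (auto simp: complex_space.scale_zero_left)
  have Q: "tr ((\<Sum>u\<in>F. u * y * star u) * (z * c)) = tr (y * z)" if z: "z \<in> center UNIV" for y z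
  proof -
    have zc: "z * c * x = x * (z * c)" for x
    proof -
      have "z * (c * x) = (x * c) * z" using center_commute[OF z, of "c * x"] cc[of x] by simp
      also have "\<dots> = x * (z * c)" using cc[of z] by (simp add: mult.assoc)
      finally show ?thesis by (simp add: mult.assoc)
    qed
    have "tr ((\<Sum>u\<in>F. u * y * star u) * (z * c)) = (\<Sum>u\<in>F. tr (y * (z * c) * (star u * u)))"
      unfolding sum_distrib_right tr_sum
    proof (intro sum.cong refl)
      fix u
      have "u * y * star u * (z * c) = u * (y * (z * c) * star u)"
        by (simp only: mult.assoc zc[of "star u", symmetric, unfolded mult.assoc])
      then show "tr (u * y * star u * (z * c)) = tr (y * (z * c) * (star u * u))"
        by (simp add: tr_commute[of u] mult.assoc)
    qed
    also have "\<dots> = tr (y * (z * c) * (\<Sum>u\<in>F. star u * u))"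
      by (simp add: sum_distrib_left tr_sum)
    also have "\<dots> = tr (y * z * (c * C))"
      using frame_sum_star[OF F star_subalgebra_UNIV] by (simp add: C_def mult.assoc)
    finally show ?thesis by (simp add: c)
  qed
  have "h * h * x = x * (h * h)" for x
    using hc[of x] hc[of "x * h"] by (simp add: mult.assoc)
  then have hh: "h * h \<in> center UNIV" by (intro centerI) auto
  \<comment> \<open>Both sides equal \<open>tr (h * h * c)\<close>: pair \<open>one\<close> with the
    square of \<open>h\<close>, and \<open>harm\<close> with \<open>h\<close> itself.\<close>
  have "t * tr (w * (h * h)) = tr ((t *\<^sub>C (\<Sum>u\<in>F. u * w * star u)) * (h * h * c))"
    by (simp add: mult_scaleC_left Q[OF hh])
  also have "\<dots> = tr (t *\<^sub>C (\<Sum>u\<in>F. u * (w * k) * star u) * (h * c))"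
    by (simp only: one harm k_def mult_1_left mult.assoc[of h])
  also have "\<dots> = t * tr (w * k * h)"
    by (simp add: mult_scaleC_left Q[OF h(1)])
  finally have eq: "tr (w * (h * h)) = tr (w * k * h)" using t0 by simp
  define d where "d = h - k"
  have sd: "star d = d" by (simp add: d_def star_diff sk h(2))
  have dw: "d * w = w * d" by (simp add: d_def left_diff_distrib right_diff_distrib wk hc[of w])
  have "w * k \<in> N" using center_in[OF w(1)] center_in[OF kN] N by (simp add: star_subalgebra_def)
  then have "tr (w * k * k) = tr (w * k * h)" using tr_cond_exp_left k_def by blast
  then have "tr (w * (d * d)) = 0"
    by (simp add: d_def left_diff_distrib right_diff_distrib eq hc[of k] mult.assoc)
  \<comment> \<open>Since \<open>w\<close> inverts the frame sum of \<open>N\<close>, the factor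
    \<open>w\<close> can be written as \<open>w\<close>, frame sum, \<open>w\<close>, which is the
    shape that \<open>frame_sum_faithful\<close> expects.\<close>
  moreover have "tr (star (w * d) * (\<Sum>v\<in>G. v * star v) * (w * d)) = tr (w * (d * d))"
  proof -
    have "star (w * d) * (\<Sum>v\<in>G. v * star v) * (w * d) = d * w * ((\<Sum>v\<in>G. v * star v) * w) * d"
      by (simp only: star_mult sd w(2) mult.assoc)
    then show ?thesis by (simp only: w(4) dw mult.assoc mult_1_left)
  qed
  ultimately have "star v * (w * d) = 0" if "v \<in> G" for v
    using frame_sum_faithful[OF frame_finite[OF G] _ that] by simp
  then have "(\<Sum>v\<in>G. v * star v) * w * d = 0"
    by (simp add: sum_distrib_right mult.assoc)
  then have "d = 0" by (simp add: w(4))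
  then show ?thesis using center_in[OF kN] by (simp add: d_def)
qed

end

section \<open>Eigenprojections and the intersection of the centers\<close>

lemma eigenprojection:
  fixes D :: "'a set"
  assumes D: "star_subalgebra D" and comm: "\<And>x y. x \<in> D \<Longrightarrow> y \<in> D \<Longrightarrow> x * y = y * x"
    and h: "h \<in> D" "star h = h"
  obtains z e where "e \<in> D" "projection e" "e \<noteq> 0" "h * e = z *\<^sub>C e"
proof -
  obtain z y where y: "y \<in> D" "y \<noteq> 0" "h * y = z *\<^sub>C y"
    using exists_eigenvector[OF fin_dim D h(1)] .
  have z: "cnj z = z"
  proof -
    have "cnj (tr (star y * (h * y))) = tr (star y * (h * y))"
      by (simp add: star_mult star_star h(2) mult.assoc flip: tr_star)
    moreover have "cnj (tr (star y * y)) = tr (star y * y)"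
      by (simp add: star_mult star_star flip: tr_star)
    moreover have "tr (star y * y) \<noteq> 0" using tr_faithful y(2) by blast
    ultimately show ?thesis by (simp add: y(3) mult_scaleC_right)
  qed
  \<comment> \<open>The eigenspace \<open>J\<close> is an ideal of the commutative algebra
    \<open>D\<close>, closed under \<open>star\<close> because \<open>z\<close> is real. Its unit is
    the required projection, found by projecting 1 orthogonally onto \<open>J\<close>.\<close>
  define J where "J = {x \<in> D. h * x = z *\<^sub>C x}"
  have sub: "complex_space.subspace D" using D by (simp add: star_subalgebra_def)
  have sJ: "complex_space.subspace J"
    using sub unfolding J_def complex_space.subspace_def
    by (auto simp: distrib_left scaleC_add_right mult_scaleC_right scaleC_scaleC mult.commute)
  have ideal: "x * d \<in> J" if "x \<in> J" "d \<in> D" for x d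
  proof -
    have "h * (x * d) = z *\<^sub>C (x * d)"
      using that by (simp add: J_def mult_scaleC_left flip: mult.assoc)
    then show ?thesis using that D by (simp add: J_def star_subalgebra_def)
  qed
  have star_J: "star x \<in> J" if "x \<in> J" for x
  proof -
    have x: "x \<in> D" "h * x = z *\<^sub>C x" using that by (auto simp: J_def)
    have sx: "star x \<in> D" using D x by (simp add: star_subalgebra_def)
    have "star x * h = z *\<^sub>C star x"
      using arg_cong[OF x(2), of star] by (simp add: star_mult star_scaleC h(2) z)
    then show ?thesis using comm[OF sx h(1)] sx by (simp add: J_def)
  qed
  obtain F where F: "frame J F" using frame_exists[OF sJ] .
  define e where "e = frame_proj F 1"
  have eJ: "e \<in> J" using frame_proj_in[OF F sJ] by (simp add: e_def)
  then have eD: "e \<in> D" by (simp add: J_def)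
  have unit: "x * e = x" if x: "x \<in> J" for x
  proof -
    define d where "d = x - x * e"
    have dJ: "d \<in> J"
      unfolding d_def using x ideal[OF x eD] sJ by (intro complex_space.subspace_diff)
    have sx: "star x \<in> D" using star_J[OF x] by (simp add: J_def)
    have "star x * d = d * star x" using comm sx dJ by (simp add: J_def)
    \<comment> \<open>As \<open>star x * d\<close> lies in \<open>J\<close>, it may be tested
      against the defining property of \<open>e\<close>; this yields that \<open>d\<close> is
      orthogonal to itself.\<close>
    then have "star x * d \<in> J" using ideal[OF dJ sx] by simp
    from frame_proj_orth[OF F this, of 1] have "tr (star d * x * e) = tr (star d * x)"
      by (simp add: e_def star_mult star_star)
    then have "tr (star d * d) = 0"
      by (simp add: d_def[of] right_diff_distrib mult.assoc)
    then show ?thesis using tr_faithful[of d] by (simp add: d_def)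
  qed
  \<comment> \<open>The left side is self-adjoint, hence so is \<open>e\<close>.\<close>
  have "star e * e = star e" using unit star_J eJ by blast
  moreover have "star (star e * e) = star e * e" by (simp add: star_mult star_star)
  ultimately have "star e = e" by (simp add: star_star)
  then have "projection e" using unit[OF eJ] by (simp add: projection_def)
  moreover have "e \<noteq> 0" using unit[of y] y by (auto simp: J_def)
  ultimately show ?thesis using that eD eJ by (auto simp: J_def)
qed

text \<open>An eigenprojection of \<open>h\<close> inside both centers must be 1 by connectedness,
  so its eigenvalue is the scalar.\<close>

lemma center_inter_scalar:
  fixes N :: "'a set"
  assumes N: "star_subalgebra N" and conn: "connected_inclusion N"
    and h: "h \<in> center N" "h \<in> center UNIV" "star h = h"
  obtains z where "h = z *\<^sub>C 1"
proof -
  have "star_subalgebra (center N \<inter> center UNIV)"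
    by (intro star_subalgebra_Int star_subalgebra_center N star_subalgebra_UNIV)
  moreover have "x * y = y * x" if "x \<in> center N \<inter> center UNIV" for x y
    using center_commute[of x UNIV y] that by simp
  ultimately obtain z e where "e \<in> center N \<inter> center UNIV" "projection e" "e \<noteq> 0" "h * e = z *\<^sub>C e"
    using eigenprojection[of "center N \<inter> center UNIV" h] h by blast
  then show ?thesis
    using connected_inclusion_projection_eq_1[OF fin_dim N conn, of e] that by simp
qed

end

section \<open>The density of the transported trace\<close>

theorem lemma3p1:
  fixes N :: "'a::unital_cstar_algebra set"
    and tr :: "'a \<Rightarrow> complex"
    and \<alpha>\<^sub>0 :: "'a \<Rightarrow> 'a"
  assumes "finite_dimensional_cstar TYPE('a)"
    and "unital_cstar_subalgebra N"
    and "connected_inclusion N"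
    and "markov_trace N tr"
    and "star_automorphism \<alpha>\<^sub>0"
    and "\<alpha>\<^sub>0 ` N = N"
  shows "tr \<circ> \<alpha>\<^sub>0 = tr"
proof -
  obtain \<tau> where \<tau>: "markov_trace_of_modulus N tr \<tau>"
    using assms(4) by (auto simp: markov_trace_def)
  interpret finite_dimensional_trace tr
    using assms(1) \<tau> by unfold_locales (auto simp: markov_trace_of_modulus_def)
  have N: "star_subalgebra N"
    using assms(2) by (rule unital_cstar_subalgebra_imp_star_subalgebra)
  have lin: "\<alpha>\<^sub>0 (x + y) = \<alpha>\<^sub>0 x + \<alpha>\<^sub>0 y" "\<alpha>\<^sub>0 (a *\<^sub>C x) = a *\<^sub>C \<alpha>\<^sub>0 x"
    and mult: "\<alpha>\<^sub>0 (x * y) = \<alpha>\<^sub>0 x * \<alpha>\<^sub>0 y" and star: "\<alpha>\<^sub>0 (star x) = star (\<alpha>\<^sub>0 x)"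
    and bij: "bij \<alpha>\<^sub>0" for x y a
    using assms(5)
    by (auto simp: star_automorphism_def Vector_Spaces.linear_def module_hom_def module_hom_axioms_def)
  define \<beta> where "\<beta> = inv \<alpha>\<^sub>0"
  have \<alpha>\<beta>: "\<alpha>\<^sub>0 (\<beta> x) = x" and \<beta>\<alpha>: "\<beta> (\<alpha>\<^sub>0 x) = x" for x
    using bij by (auto simp: \<beta>_def bij_is_surj surj_f_inv_f bij_is_inj)
  have \<alpha>_eqI: "x = y" if "\<alpha>\<^sub>0 x = \<alpha>\<^sub>0 y" for x y using that \<beta>\<alpha> by metis
  have \<alpha>_zero: "\<alpha>\<^sub>0 0 = 0" using lin(2)[of 0 0] by simp
  have \<alpha>_sum: "\<alpha>\<^sub>0 (sum f I) = (\<Sum>i\<in>I. \<alpha>\<^sub>0 (f i))" for f and I :: "'a set"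
    by (induction I rule: infinite_finite_induct) (auto simp: lin \<alpha>_zero)
  have \<alpha>_one: "\<alpha>\<^sub>0 1 = 1" by (metis \<alpha>\<beta> mult mult.left_neutral mult.right_neutral)

  obtain F where F: "frame UNIV F" using frame_exists[OF complex_space.subspace_UNIV] .
  have "complex_space.subspace N" using N by (simp add: star_subalgebra_def)
  then obtain G where G: "frame N G" using frame_exists by blast
  obtain w where w: "w \<in> center N" "star w = w" "w * (\<Sum>v\<in>G. v * star v) = 1"
    "(\<Sum>v\<in>G. v * star v) * w = 1"
    using frame_sum_inverse[OF G N] .
  \<comment> \<open>The Riesz representative of the functional
    \<open>tr \<circ> \<alpha>\<^sub>0\<close>, read off from the frame expansion. It is central
    because this functional is again a trace.\<close>
  define h where "h = (\<Sum>u\<in>F. tr (\<alpha>\<^sub>0 u) *\<^sub>C star u)"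
  have tr_h: "tr (h * x) = tr (\<alpha>\<^sub>0 x)" for x
  proof -
    have "tr (\<alpha>\<^sub>0 x) = tr (\<alpha>\<^sub>0 (\<Sum>u\<in>F. tr (star u * x) *\<^sub>C u))"
      using frame_expand[OF F] by simp
    then show ?thesis
      by (simp add: \<alpha>_sum lin tr_sum h_def sum_distrib_right mult_scaleC_left mult.commute)
  qed
  have tr_h': "tr (x * h) = tr (\<alpha>\<^sub>0 x)" for x using tr_h tr_commute by metis
  have h_comm: "h * x = x * h" for x
  proof (rule tr_nondegenerate)
    fix y
    have "tr (y * (h * x)) = tr (h * (x * y))" by (subst tr_commute) (simp add: mult.assoc)
    also have "\<dots> = tr (\<alpha>\<^sub>0 (y * x))" by (simp only: tr_h mult tr_commute)
    also have "\<dots> = tr (y * (x * h))" by (simp only: tr_h' flip: mult.assoc)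
    finally show "tr (y * (h * x)) = tr (y * (x * h))" .
  qed
  then have hc: "h \<in> center UNIV" by (intro centerI) auto
  have sh: "star h = h"
  proof (rule tr_nondegenerate)
    fix x
    have "tr (x * star h) = cnj (tr (h * star x))"
      by (simp add: star_mult star_star flip: tr_star)
    also have "\<dots> = tr (x * h)" by (simp add: tr_h tr_h' star tr_star)
    finally show "tr (x * star h) = tr (x * h)" .
  qed

  define k where "k = frame_proj G h"
  have one: "of_real \<tau> *\<^sub>C (\<Sum>u\<in>F. u * w * star u) = 1"
    by (rule markov_index[OF N G \<tau> F w(1,3)])
  \<comment> \<open>The conditional expectation onto \<open>N\<close> that preserves
    \<open>tr \<circ> \<alpha>\<^sub>0\<close>, obtained by conjugation because
    \<open>\<alpha>\<^sub>0\<close> maps \<open>N\<close> onto itself.\<close>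
  define E' where "E' x = \<beta> (frame_proj G (\<alpha>\<^sub>0 x))" for x
  have "(\<Sum>u\<in>F. \<beta> (u * w) * E' (\<beta> (star u) * x)) = x" for x
    by (rule \<alpha>_eqI)
       (simp add: \<alpha>_sum E'_def mult \<alpha>\<beta> frame_reconstruction[OF N G F w(1,3)])
  moreover have "E' y * k = frame_proj G (h * y)" for y
  proof (rule cond_exp_unique[OF N G, symmetric])
    have "\<beta> n \<in> N" if "n \<in> N" for n using that assms(6) \<beta>\<alpha> by (metis imageE)
    then have E'N: "E' y \<in> N" using cond_exp_in[OF N G] by (simp add: E'_def)
    have NN: "a * b \<in> N" if "a \<in> N" "b \<in> N" for a b using N that by (simp add: star_subalgebra_def)
    show "E' y * k \<in> N" using NN E'N cond_exp_in[OF N G] by (simp add: k_def)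
    fix n assume n: "n \<in> N"
    \<comment> \<open>Against elements of \<open>N\<close>, \<open>k\<close> may be replaced by
      \<open>h\<close>, and multiplying by \<open>h\<close> under \<open>tr\<close> amounts to
      applying \<open>\<alpha>\<^sub>0\<close>.\<close>
    have "tr (n * (E' y * k)) = tr (n * E' y * h)"
      using tr_cond_exp_left[OF N G NN[OF n E'N]] by (simp add: k_def mult.assoc)
    also have "\<dots> = tr (\<alpha>\<^sub>0 n * frame_proj G (\<alpha>\<^sub>0 y))"
      by (simp add: tr_h' mult E'_def \<alpha>\<beta>)
    also have "\<dots> = tr (\<alpha>\<^sub>0 n * \<alpha>\<^sub>0 y)"
      using tr_cond_exp_left[OF N G] n assms(6) by blast
    also have "\<dots> = tr (n * (h * y))"
      by (simp add: tr_h' h_comm[of y] flip: mult mult.assoc)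
    finally show "tr (n * (E' y * k)) = tr (n * (h * y))" .
  qed
  ultimately have "(\<Sum>u\<in>F. u * w * k * star u) = (\<Sum>u\<in>F. \<beta> (u * w) * \<beta> (star u)) * h"
    using frame_reconstruction[OF N G F w(1,3)] hc
    by (intro density_transfer[OF N G, where E' = E']) auto
  \<comment> \<open>Applying \<open>\<alpha>\<^sub>0\<close> turns this sum into the one of
    \<open>one\<close>.\<close>
  moreover have "of_real \<tau> *\<^sub>C (\<Sum>u\<in>F. \<beta> (u * w) * \<beta> (star u)) = 1"
    by (rule \<alpha>_eqI) (simp add: \<alpha>_sum lin mult \<alpha>\<beta> \<alpha>_one one)
  ultimately have "of_real \<tau> *\<^sub>C (\<Sum>u\<in>F. u * (w * k) * star u) = h"
    by (simp add: mult.assoc flip: mult_scaleC_left)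
  then have "h \<in> N"
    unfolding k_def by (rule harmonic_in_subalgebra[OF N G F w hc sh one])
  then have "h \<in> center N" using h_comm by (intro centerI)
  then obtain z where z: "h = z *\<^sub>C 1"
    using center_inter_scalar[OF N assms(3) _ hc sh] by blast
  \<comment> \<open>The scalar is \<open>tr h\<close>, which equals the trace of the image of
    1.\<close>
  then have "h = 1" using tr_h[of 1] by (simp add: \<alpha>_one)
  then show ?thesis using tr_h by auto
qed

end
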